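(* Let $m_1$ and $m_2$ be mass functions on frames $\Theta_1$ and $\Theta_2$ respectively, let $\Upsilon=\Upsilon_{1,2}$ be their set of essential conflict elements, let $\Omega$ be the extended effective frame, let $m_1',m_2'$ be the functions on $\Omega$ obtained from $m_1,m_2$ by the Full Negation Belief Transformation (FNBT), and let $m_{1,2}=m_1\oplus m_2$ and $m_{1,2}'=m_1'\oplus m_2'$ be the Dempster combinations. If $\Upsilon=\emptyset$, then FNBT preserves the original mass functions and their combination: 1. $\Omega=\Theta_1=\Theta_2$; 2. $m_i'(A)=m_i(A)$ for all $A\subseteq\Theta$ and $i=1,2$, where $\Theta=\Theta_1=\Theta_2$; 3. $m_{1,2}'=m_{1,2}$.
   Context: A frame $\Theta$ is a finite set of mutually exclusive and exhaustive elements. A mass function on $\Theta$ is a map $m:2^\Theta\to[0,1]$ with $m(\emptyset)=0$ and $\sum_{A\subseteq\Theta}m(A)=1$. A focal element of $m$ is a subset $A\subseteq\Theta$ with $m(A)>0$. Essential conflict elements: let $F_1,F_2$ be the sets of focal elements of $m_1,m_2$. Then $\Upsilon_{1,2}\subseteq\Theta_1\cup\Theta_2$ is the set of all $\omega$ for which there are $i\neq j$ in $\{1,2\}$ and $A\in F_i$ with $\omega\in A$ such that $A\cap B=\emptyset$ for all $B\in F_j$. Effective frame: $\Theta_i^*=\{\omega\in\Theta_i\mid\exists A\subseteq\Theta_i,\ m_i(A)>0\text{ and }\omega\in A\}$. Extended effective frame: $\Omega=\Theta_1^*\cup\Theta_2^*=\Theta_1^*\cup\Upsilon_{1,2}=\Theta_2^*\cup\Upsilon_{1,2}$;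 the equality of these three expressions is taken as part of the definition. Full Negation Belief Transformation: for each focal element $A$ of $m_i$, $$m_i'\Big(\Omega\setminus\bigcup_{\omega\in\Theta_i^*,\ \omega\notin A}\{\omega\}\Big)=m_i(A),$$ and $m_i'$ is $0$ on every subset of $\Omega$ not of this form. Dempster's combination rule $\oplus$: with $k_{1,2}=\sum_{A\cap B=\emptyset}m_1(A)m_2(B)<1$, the combination is $m_{1,2}(\emptyset)=0$ and $m_{1,2}(x)=\frac{1}{1-k_{1,2}}\sum_{A\cap B=x}m_1(A)m_2(B)$ for $x\neq\emptyset$.
   Formalization: Item 1 as printed fails if a frame has an element in no focal element (Θ1={a,b}, Θ2={a}, m1({a})=m2({a})=1). Proved instead: Ω=Θ1*=Θ2*, and Ω=Θ1=Θ2 when Θ1*=Θ1 and Θ2*=Θ2; item 2 is stated for all A⊆Θi. *)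

theory Defs
  imports Complex_Main
begin

text \<open>
  Both frames live in one type \<open>'a\<close>. The functions \<open>m\<close> below are total on \<open>'a set\<close>, but a mass
  function is only constrained on, and every definition only reads it on, subsets of its frame.
\<close>

definition mass_function :: "'a set \<Rightarrow> ('a set \<Rightarrow> real) \<Rightarrow> bool" where
  "mass_function \<Theta> m \<longleftrightarrow>
     finite \<Theta> \<and> (\<forall>A\<subseteq>\<Theta>. 0 \<le> m A \<and> m A \<le> 1) \<and> m {} = 0 \<and> (\<Sum>A\<in>Pow \<Theta>. m A) = 1"

definition focal_elements :: "'a set \<Rightarrow> ('a set \<Rightarrow> real) \<Rightarrow> 'a set set" where
  "focal_elements \<Theta> m = {A. A \<subseteq> \<Theta> \<and> m A > 0}"

definition essential_conflict ::
  "'a set \<Rightarrow> ('a set \<Rightarrow> real) \<Rightarrow> 'a set \<Rightarrow> ('a set \<Rightarrow> real) \<Rightarrow> 'a set" where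
  "essential_conflict \<Theta>1 m1 \<Theta>2 m2 =
     {\<omega> \<in> \<Theta>1 \<union> \<Theta>2.
        (\<exists>A\<in>focal_elements \<Theta>1 m1. \<omega> \<in> A \<and> (\<forall>B\<in>focal_elements \<Theta>2 m2. A \<inter> B = {})) \<or>
        (\<exists>A\<in>focal_elements \<Theta>2 m2. \<omega> \<in> A \<and> (\<forall>B\<in>focal_elements \<Theta>1 m1. A \<inter> B = {}))}"

definition effective_frame :: "'a set \<Rightarrow> ('a set \<Rightarrow> real) \<Rightarrow> 'a set" where
  "effective_frame \<Theta> m = {\<omega> \<in> \<Theta>. \<exists>A\<subseteq>\<Theta>. m A > 0 \<and> \<omega> \<in> A}"

text \<open>
  The three expressions for the extended effective frame do not agree for every pair of mass
  functions (e.g. \<open>m1 {a,b} = 1\<close>, \<open>m2 {a} = 1\<close>). Their agreement is part of the definition,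
  hence a predicate on \<open>\<Omega>\<close> rather than a function.
\<close>

definition extended_effective_frame ::
  "'a set \<Rightarrow> ('a set \<Rightarrow> real) \<Rightarrow> 'a set \<Rightarrow> ('a set \<Rightarrow> real) \<Rightarrow> 'a set \<Rightarrow> bool" where
  "extended_effective_frame \<Theta>1 m1 \<Theta>2 m2 \<Omega> \<longleftrightarrow>
     \<Omega> = effective_frame \<Theta>1 m1 \<union> effective_frame \<Theta>2 m2 \<and>
     \<Omega> = effective_frame \<Theta>1 m1 \<union> essential_conflict \<Theta>1 m1 \<Theta>2 m2 \<and>
     \<Omega> = effective_frame \<Theta>2 m2 \<union> essential_conflict \<Theta>1 m1 \<Theta>2 m2"

definition full_negation :: "'a set \<Rightarrow> 'a set \<Rightarrow> ('a set \<Rightarrow> real) \<Rightarrow> 'a set \<Rightarrow> 'a set" where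
  "full_negation \<Omega> \<Theta> m A = \<Omega> - (\<Union>\<omega>\<in>{\<omega> \<in> effective_frame \<Theta> m. \<omega> \<notin> A}. {\<omega>})"

text \<open>
  \<open>fnbt \<Omega> \<Theta> m\<close> is the transformed mass function on \<open>\<Omega>\<close>, and 0 on sets that are not subsets
  of \<open>\<Omega>\<close>. The description is justified by \<open>inj_on_full_negation\<close> below.
\<close>

definition fnbt :: "'a set \<Rightarrow> 'a set \<Rightarrow> ('a set \<Rightarrow> real) \<Rightarrow> 'a set \<Rightarrow> real" where
  "fnbt \<Omega> \<Theta> m X =
     (if X \<in> full_negation \<Omega> \<Theta> m ` focal_elements \<Theta> m
      then m (THE A. A \<in> focal_elements \<Theta> m \<and> X = full_negation \<Omega> \<Theta> m A)
      else 0)"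

lemma inj_on_full_negation:
  assumes "effective_frame \<Theta> m \<subseteq> \<Omega>"
  shows "inj_on (full_negation \<Omega> \<Theta> m) (focal_elements \<Theta> m)"
proof (rule inj_onI)
  fix A B
  assume A: "A \<in> focal_elements \<Theta> m" and B: "B \<in> focal_elements \<Theta> m"
    and eq: "full_negation \<Omega> \<Theta> m A = full_negation \<Omega> \<Theta> m B"
  have "full_negation \<Omega> \<Theta> m C \<inter> effective_frame \<Theta> m = C" if "C \<in> focal_elements \<Theta> m" for C
    using that assms by (auto simp: full_negation_def effective_frame_def focal_elements_def)
  with A B eq show "A = B" by metis
qed

lemma fnbt_full_negation:
  assumes "effective_frame \<Theta> m \<subseteq> \<Omega>" and "A \<in> focal_elements \<Theta> m"
  shows "fnbt \<Omega> \<Theta> m (full_negation \<Omega> \<Theta> m A) = m A"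
proof -
  have "(THE B. B \<in> focal_elements \<Theta> m \<and> full_negation \<Omega> \<Theta> m A = full_negation \<Omega> \<Theta> m B) = A"
    using inj_onD[OF inj_on_full_negation[OF assms(1)]] assms(2) by (intro the_equality) auto
  then show ?thesis using assms(2) by (simp add: fnbt_def)
qed

definition conflict ::
  "'a set \<Rightarrow> ('a set \<Rightarrow> real) \<Rightarrow> 'a set \<Rightarrow> ('a set \<Rightarrow> real) \<Rightarrow> real" where
  "conflict \<Theta>1 m1 \<Theta>2 m2 =
     (\<Sum>(A, B)\<in>{(A, B). A \<subseteq> \<Theta>1 \<and> B \<subseteq> \<Theta>2 \<and> A \<inter> B = {}}. m1 A * m2 B)"

text \<open>Meaningful only if \<open>conflict \<Theta>1 m1 \<Theta>2 m2 < 1\<close>.\<close>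

definition dempster ::
  "'a set \<Rightarrow> ('a set \<Rightarrow> real) \<Rightarrow> 'a set \<Rightarrow> ('a set \<Rightarrow> real) \<Rightarrow> 'a set \<Rightarrow> real" where
  "dempster \<Theta>1 m1 \<Theta>2 m2 X =
     (if X = {} then 0
      else 1 / (1 - conflict \<Theta>1 m1 \<Theta>2 m2) *
        (\<Sum>(A, B)\<in>{(A, B). A \<subseteq> \<Theta>1 \<and> B \<subseteq> \<Theta>2 \<and> A \<inter> B = X}. m1 A * m2 B))"

end

theory Submission
  imports Defs
begin

text \<open>
  If no element is in essential conflict, both effective frames coincide with \<open>\<Omega>\<close>, so negating a
  focal element inside \<open>\<Omega>\<close> removes exactly its complement and gives the element back. The frames
  may still be larger than \<open>\<Omega>\<close>, but the masses vanish on every set not contained in \<open>\<Omega>\<close>, hence all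
  sums in Dempster's rule agree.
\<close>

lemma focal_subset_effective_frame:
  "A \<in> focal_elements \<Theta> m \<Longrightarrow> A \<subseteq> effective_frame \<Theta> m"
  by (auto simp: focal_elements_def effective_frame_def)

lemma full_negation_effective_frame:
  assumes "A \<in> focal_elements \<Theta> m"
  shows "full_negation (effective_frame \<Theta> m) \<Theta> m A = A"
  using focal_subset_effective_frame[OF assms] by (auto simp: full_negation_def)

lemma mass_function_not_focal:
  assumes "mass_function \<Theta> m" and "A \<subseteq> \<Theta>" and "A \<notin> focal_elements \<Theta> m"
  shows "m A = 0"
  using assms by (force simp: mass_function_def focal_elements_def)

lemma fnbt_effective_frame:
  assumes "mass_function \<Theta> m" and "A \<subseteq> \<Theta>"
  shows "fnbt (effective_frame \<Theta> m) \<Theta> m A = m A"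
proof (cases "A \<in> focal_elements \<Theta> m")
  case True
  then show ?thesis
    using fnbt_full_negation[of \<Theta> m "effective_frame \<Theta> m" A]
    by (simp add: full_negation_effective_frame)
next
  case False
  \<comment> \<open>Every focal element is its own negation here, so a non-focal \<open>A\<close> is
    not in the image and receives the default value 0; its mass is 0 as well, since masses are
    nonnegative.\<close>
  have "full_negation (effective_frame \<Theta> m) \<Theta> m ` focal_elements \<Theta> m = focal_elements \<Theta> m"
    by (simp add: full_negation_effective_frame)
  with False show ?thesis
    using mass_function_not_focal[OF assms False] by (simp add: fnbt_def)
qed

lemma mass_function_focal_exists:
  assumes "mass_function \<Theta> m"
  obtains A where "A \<in> focal_elements \<Theta> m"
proof -
  have "(\<Sum>A\<in>Pow \<Theta>. m A) \<noteq> 0"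
    using assms by (simp add: mass_function_def)
  then obtain A where "A \<subseteq> \<Theta>" "m A \<noteq> 0"
    by (meson PowD sum.neutral)
  then show thesis
    using that mass_function_not_focal[OF assms] by blast
qed

text \<open>A focal element \<open>A\<close> of \<open>m1\<close> is nonempty because
  \<open>m1 {} = 0\<close>. A point of \<open>A\<close> is not in essential conflict, so
  \<open>A\<close> cannot be disjoint from every focal element of \<open>m2\<close>. The pair found
  is what keeps the conflict below 1.\<close>

lemma no_essential_conflict_meeting_focal:
  assumes "mass_function \<Theta>1 m1" and "essential_conflict \<Theta>1 m1 \<Theta>2 m2 = {}"
  obtains A B where "A \<in> focal_elements \<Theta>1 m1" "B \<in> focal_elements \<Theta>2 m2" "A \<inter> B \<noteq> {}"
proof -
  obtain A where A: "A \<in> focal_elements \<Theta>1 m1"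
    using mass_function_focal_exists[OF assms(1)] .
  have "A \<noteq> {}"
    using A assms(1) by (auto simp: focal_elements_def mass_function_def)
  then obtain \<omega> where \<omega>: "\<omega> \<in> A" by blast
  then have "\<omega> \<in> \<Theta>1"
    using A by (auto simp: focal_elements_def)
  moreover have "\<omega> \<notin> essential_conflict \<Theta>1 m1 \<Theta>2 m2"
    using assms(2) by simp
  ultimately obtain B where "B \<in> focal_elements \<Theta>2 m2" "A \<inter> B \<noteq> {}"
    using A \<omega> unfolding essential_conflict_def by blast
  with A that show thesis by blast
qed

text \<open>Over all pairs of subsets of the two frames the nonnegative products of masses add up to
  1, the product of the two total masses. The disjoint pairs leave out the given meeting pair, whose
  product is positive.\<close>

lemma conflict_less_one:
  assumes m1: "mass_function \<Theta>1 m1" and m2: "mass_function \<Theta>2 m2"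
    and A: "A \<in> focal_elements \<Theta>1 m1" and B: "B \<in> focal_elements \<Theta>2 m2" and "A \<inter> B \<noteq> {}"
  shows "conflict \<Theta>1 m1 \<Theta>2 m2 < 1"
proof -
  let ?D = "{(A, B). A \<subseteq> \<Theta>1 \<and> B \<subseteq> \<Theta>2 \<and> A \<inter> B = {}}"
  have fin: "finite (Pow \<Theta>1 \<times> Pow \<Theta>2)"
    using m1 m2 by (simp add: mass_function_def)
  have "conflict \<Theta>1 m1 \<Theta>2 m2 < (\<Sum>(A, B)\<in>Pow \<Theta>1 \<times> Pow \<Theta>2. m1 A * m2 B)"
    unfolding conflict_def
  proof (rule sum_strict_mono2[OF fin])
    show "(A, B) \<in> Pow \<Theta>1 \<times> Pow \<Theta>2 - ?D"
      using A B \<open>A \<inter> B \<noteq> {}\<close> by (auto simp: focal_elements_def)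
    show "0 < (case (A, B) of (A, B) \<Rightarrow> m1 A * m2 B)"
      using A B by (simp add: focal_elements_def)
  qed (use m1 m2 in \<open>auto simp: mass_function_def\<close>)
  also have "\<dots> = (\<Sum>A\<in>Pow \<Theta>1. m1 A) * (\<Sum>B\<in>Pow \<Theta>2. m2 B)"
    by (simp add: sum_product sum.cartesian_product)
  also have "\<dots> = 1"
    using m1 m2 by (simp add: mass_function_def)
  finally show ?thesis .
qed

text \<open>In the application \<open>n1\<close> and \<open>n2\<close> are the transformed masses. A
  pair lost by shrinking the frames to \<Omega> has a component not contained in \<Omega>, so one
  factor of its product is 0. Leaving \<open>X\<close> arbitrary covers both the conflict
  (\<open>X = {}\<close>) and the numerators of the combination.\<close>

lemma intersection_sum_restrict:
  fixes m1 m2 n1 n2 :: "'a set \<Rightarrow> real"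
  assumes "finite \<Theta>1" "finite \<Theta>2" "\<Omega> \<subseteq> \<Theta>1" "\<Omega> \<subseteq> \<Theta>2"
    and "\<And>A. A \<subseteq> \<Omega> \<Longrightarrow> n1 A = m1 A" and "\<And>A. A \<subseteq> \<Omega> \<Longrightarrow> n2 A = m2 A"
    and "\<And>A. A \<subseteq> \<Theta>1 \<Longrightarrow> \<not> A \<subseteq> \<Omega> \<Longrightarrow> m1 A = 0" and "\<And>A. A \<subseteq> \<Theta>2 \<Longrightarrow> \<not> A \<subseteq> \<Omega> \<Longrightarrow> m2 A = 0"
  shows "(\<Sum>(A, B)\<in>{(A, B). A \<subseteq> \<Omega> \<and> B \<subseteq> \<Omega> \<and> A \<inter> B = X}. n1 A * n2 B) =
         (\<Sum>(A, B)\<in>{(A, B). A \<subseteq> \<Theta>1 \<and> B \<subseteq> \<Theta>2 \<and> A \<inter> B = X}. m1 A * m2 B)"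
proof (rule sum.mono_neutral_cong_left)
  show "finite {(A, B). A \<subseteq> \<Theta>1 \<and> B \<subseteq> \<Theta>2 \<and> A \<inter> B = X}"
    by (rule finite_subset[of _ "Pow \<Theta>1 \<times> Pow \<Theta>2"]) (use assms(1,2) in auto)
  show "{(A, B). A \<subseteq> \<Omega> \<and> B \<subseteq> \<Omega> \<and> A \<inter> B = X} \<subseteq> {(A, B). A \<subseteq> \<Theta>1 \<and> B \<subseteq> \<Theta>2 \<and> A \<inter> B = X}"
    using assms(3,4) by blast
  show "\<forall>p\<in>{(A, B). A \<subseteq> \<Theta>1 \<and> B \<subseteq> \<Theta>2 \<and> A \<inter> B = X} -
      {(A, B). A \<subseteq> \<Omega> \<and> B \<subseteq> \<Omega> \<and> A \<inter> B = X}. (case p of (A, B) \<Rightarrow> m1 A * m2 B) = 0"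
  proof
    fix p
    assume p: "p \<in> {(A, B). A \<subseteq> \<Theta>1 \<and> B \<subseteq> \<Theta>2 \<and> A \<inter> B = X} -
      {(A, B). A \<subseteq> \<Omega> \<and> B \<subseteq> \<Omega> \<and> A \<inter> B = X}"
    obtain A B where [simp]: "p = (A, B)"
      by (cases p)
    have "A \<subseteq> \<Theta>1" "B \<subseteq> \<Theta>2" "\<not> A \<subseteq> \<Omega> \<or> \<not> B \<subseteq> \<Omega>"
      using p unfolding \<open>p = (A, B)\<close> by blast+
    then have "m1 A = 0 \<or> m2 B = 0"
      using assms(7,8) by metis
    then show "(case p of (A, B) \<Rightarrow> m1 A * m2 B) = 0"
      by auto
  qed
qed (use assms(5,6) in auto)

text \<open>Elements outside every focal element are invisible to \<Omega>: if a and b are distinct,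
  \<Theta>1 = {a, b}, \<Theta>2 = {a} and both masses are concentrated on {a}, nothing is in
  essential conflict, yet \<Omega> = {a} differs from \<Theta>1. Hence equality with the frames is
  claimed for frames that equal their effective frames. The two bounds on \<open>conflict\<close>
  make both combinations meaningful.\<close>

theorem theorem4:
  fixes \<Theta>1 \<Theta>2 \<Omega> :: "'a set" and m1 m2 :: "'a set \<Rightarrow> real"
  assumes "mass_function \<Theta>1 m1" and "mass_function \<Theta>2 m2"
    and "extended_effective_frame \<Theta>1 m1 \<Theta>2 m2 \<Omega>"
    and "essential_conflict \<Theta>1 m1 \<Theta>2 m2 = {}"
  shows "(\<Omega> = effective_frame \<Theta>1 m1 \<and> \<Omega> = effective_frame \<Theta>2 m2 \<and>
          (effective_frame \<Theta>1 m1 = \<Theta>1 \<and> effective_frame \<Theta>2 m2 = \<Theta>2 \<longrightarrow> \<Omega> = \<Theta>1 \<and> \<Theta>1 = \<Theta>2)) \<and>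
         ((\<forall>A\<subseteq>\<Theta>1. fnbt \<Omega> \<Theta>1 m1 A = m1 A) \<and> (\<forall>A\<subseteq>\<Theta>2. fnbt \<Omega> \<Theta>2 m2 A = m2 A)) \<and>
         (conflict \<Theta>1 m1 \<Theta>2 m2 < 1 \<and>
          conflict \<Omega> (fnbt \<Omega> \<Theta>1 m1) \<Omega> (fnbt \<Omega> \<Theta>2 m2) < 1 \<and>
          dempster \<Omega> (fnbt \<Omega> \<Theta>1 m1) \<Omega> (fnbt \<Omega> \<Theta>2 m2) = dempster \<Theta>1 m1 \<Theta>2 m2)"
proof -
  let ?n1 = "fnbt \<Omega> \<Theta>1 m1" and ?n2 = "fnbt \<Omega> \<Theta>2 m2"
  \<comment> \<open>With no essential conflict, the last two of the three expressions for \<Omega>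
    reduce to the single effective frames.\<close>
  have \<Omega>: "\<Omega> = effective_frame \<Theta>1 m1" "\<Omega> = effective_frame \<Theta>2 m2"
    using assms(3,4) unfolding extended_effective_frame_def by (metis sup_bot_right)+
  have fnbt: "\<And>A. A \<subseteq> \<Theta>1 \<Longrightarrow> ?n1 A = m1 A" "\<And>A. A \<subseteq> \<Theta>2 \<Longrightarrow> ?n2 A = m2 A"
    using fnbt_effective_frame[OF assms(1)] fnbt_effective_frame[OF assms(2)] \<Omega> by simp_all
  have sub: "\<Omega> \<subseteq> \<Theta>1" "\<Omega> \<subseteq> \<Theta>2"
    unfolding \<Omega>(1) using \<Omega> by (auto simp: effective_frame_def)
  have zero: "\<And>A. A \<subseteq> \<Theta>1 \<Longrightarrow> \<not> A \<subseteq> \<Omega> \<Longrightarrow> m1 A = 0" "\<And>A. A \<subseteq> \<Theta>2 \<Longrightarrow> \<not> A \<subseteq> \<Omega> \<Longrightarrow> m2 A = 0"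
    using mass_function_not_focal[OF assms(1)] mass_function_not_focal[OF assms(2)]
      focal_subset_effective_frame \<Omega> by metis+
  have sums: "(\<Sum>(A, B)\<in>{(A, B). A \<subseteq> \<Omega> \<and> B \<subseteq> \<Omega> \<and> A \<inter> B = X}. ?n1 A * ?n2 B) =
      (\<Sum>(A, B)\<in>{(A, B). A \<subseteq> \<Theta>1 \<and> B \<subseteq> \<Theta>2 \<and> A \<inter> B = X}. m1 A * m2 B)" for X
    by (rule intersection_sum_restrict)
      (use assms(1,2) sub fnbt zero in \<open>auto simp: mass_function_def\<close>)
  have conflict_eq: "conflict \<Omega> ?n1 \<Omega> ?n2 = conflict \<Theta>1 m1 \<Theta>2 m2"
    using sums[of "{}"] by (simp add: conflict_def)
  \<comment> \<open>Equality as functions on all sets: \<open>{}\<close> gets 0 on both sides, and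
    elsewhere \<open>sums\<close> applies to every \<open>X\<close>, contained in \<Omega> or
    not.\<close>
  have "dempster \<Omega> ?n1 \<Omega> ?n2 = dempster \<Theta>1 m1 \<Theta>2 m2"
    by (simp add: fun_eq_iff dempster_def conflict_eq sums)
  moreover have "conflict \<Theta>1 m1 \<Theta>2 m2 < 1"
    using no_essential_conflict_meeting_focal[OF assms(1,4)] conflict_less_one[OF assms(1,2)]
    by metis
  ultimately show ?thesis
    using \<Omega> fnbt conflict_eq by auto
qed

end
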